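(* Let $\nu>\tfrac{1}{2}$. Then, for all $x>0$, $$I_{\nu}(x)<\frac{x^\nu}{2^{\nu-1}\Gamma(\nu)}\,{}_1F_2\bigg(\frac{1}{2};\frac{3}{2},\nu;\frac{x^2}{4}\bigg) <2\nu I_\nu(x)-(2\nu-1)I_{\nu+2}(x).$$
   Context: For $x>0$ and $\nu>-1$ the modified Bessel function of the first kind is $I_\nu(x)=\sum_{k=0}^\infty\frac{(x/2)^{\nu+2k}}{k!\,\Gamma(\nu+k+1)}$. The generalized hypergeometric function is ${}_1F_2(a;b_1,b_2;z)=\sum_{k=0}^\infty\frac{(a)_k}{(b_1)_k(b_2)_k}\frac{z^k}{k!}$, where $(a)_0=1$ and $(a)_k=a(a+1)\cdots(a+k-1)$ for $k\ge1$. *)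

theory Defs
  imports "HOL-Analysis.Analysis"
begin

text \<open>Real-valued, intended for \<open>x > 0\<close> (\<open>powr\<close> is the real power only there) and \<open>\<nu> > -1\<close>
  (so that no argument of \<open>Gamma\<close> is a pole).\<close>

definition bessel_I :: "real \<Rightarrow> real \<Rightarrow> real" where
  "bessel_I \<nu> x =
     (\<Sum>k. (x / 2) powr (\<nu> + 2 * real k) / (fact k * Gamma (\<nu> + real k + 1)))"

text \<open>Intended for \<open>b1\<close>, \<open>b2\<close> not nonpositive integers; \<open>pochhammer a k\<close> is the rising
  factorial.\<close>

definition hypergeo_1F2 :: "real \<Rightarrow> real \<Rightarrow> real \<Rightarrow> real \<Rightarrow> real" where
  "hypergeo_1F2 a b1 b2 z =
     (\<Sum>k. pochhammer a k / (pochhammer b1 k * pochhammer b2 k) * (z ^ k / fact k))"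

lemma hypergeo_1F2_eq_eval_fps:
  "hypergeo_1F2 a b1 b2 z = eval_fps (fps_hypergeo [a] [b1, b2] 1) z"
  by (simp add: hypergeo_1F2_def eval_fps_def mult_ac)

end

theory Submission
  imports Defs
begin

text \<open>All three members are power series in \<open>x / 2\<close>, and the inequalities hold termwise. Relative to
  the coefficients of \<open>I\<^sub>\<nu>\<close>, those of the middle member are \<open>2 (\<nu> + k) / (2 k + 1)\<close> and those of
  the upper bound are \<open>2 \<nu> - (2 \<nu> - 1) k / (\<nu> + k + 1)\<close>, so everything reduces to two inequalities
  between rational functions. The second is an equality at \<open>k = 0\<close> and strict afterwards.\<close>

text \<open>The difference series has nonnegative terms and a positive one at \<open>i\<close>.
  Strictness at a single index matters for the upper bound, whose comparison is an equality at index
  0.\<close>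

lemma suminf_strict_mono:
  fixes f g :: "nat \<Rightarrow> real"
  assumes f: "summable f" and g: "summable g" and le: "\<And>n. f n \<le> g n" and less: "f i < g i"
  shows "suminf f < suminf g"
proof -
  have "0 < (\<Sum>n. g n - f n)"
    by (rule suminf_pos2[OF summable_diff[OF g f], of i]) (use le less in simp_all)
  then show ?thesis
    by (simp flip: suminf_diff[OF g f])
qed

definition bessel_I_term :: "real \<Rightarrow> real \<Rightarrow> nat \<Rightarrow> real" where
  "bessel_I_term \<nu> x k = (x / 2) powr (\<nu> + 2 * real k) / (fact k * Gamma (\<nu> + real k + 1))"

lemma bessel_I_eq_suminf: "bessel_I \<nu> x = (\<Sum>k. bessel_I_term \<nu> x k)"
  by (simp add: bessel_I_def bessel_I_term_def)

lemma bessel_I_term_pos: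
  assumes "\<nu> > -1" "x > 0"
  shows "bessel_I_term \<nu> x k > 0"
  using assms by (simp add: bessel_I_term_def Gamma_real_pos)

lemma Gamma_plus_of_nat:
  fixes z :: real
  assumes "z > 0"
  shows "Gamma (z + real k) = Gamma z * pochhammer z k"
proof -
  have "z \<notin> \<int>\<^sub>\<le>\<^sub>0" using assms by (auto elim!: nonpos_Ints_cases)
  moreover have "Gamma z > 0" using assms by (rule Gamma_real_pos)
  ultimately show ?thesis
    by (simp add: pochhammer_Gamma)
qed

lemma half_powr_plus_twice:
  assumes "x > (0::real)"
  shows "(x / 2) powr (a + 2 * real k) = (x / 2) powr a * (x\<^sup>2 / 4) ^ k"
proof -
  have "(x / 2) powr (2 * real k) = (x / 2) ^ (2 * k)"
    using assms powr_realpow[of "x / 2" "2 * k"] by simp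
  also have "\<dots> = (x\<^sup>2 / 4) ^ k"
    by (simp add: power_mult power_divide)
  finally show ?thesis
    by (simp add: powr_add)
qed

text \<open>For \<open>\<nu> \<ge> 0\<close> every factor of \<open>pochhammer (\<nu> + 1) k\<close>
  is at least 1, so the terms are dominated by a constant multiple of the exponential series at
  \<open>x\<^sup>2 / 4\<close>.\<close>

lemma summable_bessel_I_term:
  assumes "\<nu> \<ge> 0" "x > 0"
  shows "summable (bessel_I_term \<nu> x)"
proof -
  define C where "C = (x / 2) powr \<nu> / Gamma (\<nu> + 1)"
  have G: "Gamma (\<nu> + 1) > 0" using assms by (intro Gamma_real_pos) simp
  have ge1: "1 \<le> pochhammer (\<nu> + 1) k" for k
    unfolding pochhammer_prod by (rule prod_ge_1) (use assms in simp)
  have bound: "bessel_I_term \<nu> x k \<le> C * ((x\<^sup>2 / 4) ^ k /\<^sub>R fact k)" for k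
  proof -
    have "bessel_I_term \<nu> x k = C * ((x\<^sup>2 / 4) ^ k / fact k) / pochhammer (\<nu> + 1) k"
      using Gamma_plus_of_nat[of "\<nu> + 1" k] assms
      unfolding bessel_I_term_def half_powr_plus_twice[OF assms(2)] by (simp add: C_def add_ac)
    also have "\<dots> \<le> C * ((x\<^sup>2 / 4) ^ k / fact k) / 1"
      using ge1[of k] G by (intro divide_left_mono) (auto simp: C_def)
    finally show ?thesis by (simp add: field_simps)
  qed
  show ?thesis
  proof (rule summable_comparison_test')
    show "summable (\<lambda>k. C * ((x\<^sup>2 / 4) ^ k /\<^sub>R fact k))"
      by (intro summable_mult summable_exp_generic)
    show "norm (bessel_I_term \<nu> x k) \<le> C * ((x\<^sup>2 / 4) ^ k /\<^sub>R fact k)" if "k \<ge> 0" for k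
      using bound[of k] bessel_I_term_pos[of \<nu> x k] assms by simp
  qed
qed

text \<open>The factor \<open>k\<close> lowers \<open>fact k\<close> to \<open>fact (k - 1)\<close>
  and \<open>\<nu> + k + 1\<close> raises the Gamma argument by one, giving term
  \<open>k - 1\<close> of the series of order \<open>\<nu> + 2\<close>. Both Bessel series can then
  be compared index by index.\<close>

lemma bessel_I_add_2_sums:
  assumes "\<nu> \<ge> 0" "x > 0"
  shows "(\<lambda>k. bessel_I_term \<nu> x k * (real k / (\<nu> + real k + 1))) sums bessel_I (\<nu> + 2) x"
proof -
  have shift: "bessel_I_term \<nu> x (Suc k) * (real (Suc k) / (\<nu> + real (Suc k) + 1))
      = bessel_I_term (\<nu> + 2) x k" for k
  proof -
    have "Gamma (\<nu> + real k + 2 + 1) = (\<nu> + real k + 2) * Gamma (\<nu> + real k + 2)"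
      using assms by (intro Gamma_plus1) (auto elim!: nonpos_Ints_cases)
    then have G: "Gamma (\<nu> + 2 + real k + 1) = (\<nu> + real k + 2) * Gamma (\<nu> + real k + 2)"
      by (simp add: add_ac)
    have "bessel_I_term \<nu> x (Suc k) * (real (Suc k) / (\<nu> + real (Suc k) + 1))
      = (x / 2) powr (\<nu> + 2 + 2 * real k) / (real (Suc k) * fact k * Gamma (\<nu> + real k + 2))
        * (real (Suc k) / (\<nu> + real k + 2))"
      by (simp add: bessel_I_term_def add_ac distrib_left)
    also have "\<dots> = bessel_I_term (\<nu> + 2) x k"
      unfolding bessel_I_term_def G by (simp del: of_nat_Suc)
    finally show ?thesis .
  qed
  have "bessel_I_term (\<nu> + 2) x sums bessel_I (\<nu> + 2) x"
    unfolding bessel_I_eq_suminf using assms by (intro summable_sums summable_bessel_I_term) auto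
  then show ?thesis
    \<comment> \<open>Undoing the index shift adds a term at index 0, which vanishes because of the
      factor \<open>real k\<close>.\<close>
    unfolding shift[symmetric] by (subst (asm) sums_Suc_iff) simp
qed

lemma hypergeo_1F2_half_term:
  assumes "\<nu> > 0" "x > 0"
  shows "x powr \<nu> / (2 powr (\<nu> - 1) * Gamma \<nu>)
      * (pochhammer (1/2) k / (pochhammer (3/2) k * pochhammer \<nu> k) * ((x\<^sup>2 / 4) ^ k / fact k))
    = bessel_I_term \<nu> x k * (2 * (\<nu> + real k) / (2 * real k + 1))"
proof -
  \<comment> \<open>Both sides are \<open>pochhammer (1/2) (Suc k)\<close>, with the last factor
    split off on the left and the first on the right.\<close>
  have "pochhammer (1/2 :: real) k * (1/2 + real k) = 1/2 * pochhammer (3/2) k"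
    using pochhammer_rec[of "1/2 :: real" k] by (simp add: pochhammer_Suc)
  moreover have "pochhammer (3/2 :: real) k > 0" by (rule pochhammer_pos) simp
  ultimately have ratio: "pochhammer (1/2) k / pochhammer (3/2) k = 1 / (2 * real k + 1)"
    by (simp add: field_simps)
  have G: "Gamma \<nu> * pochhammer \<nu> k = Gamma (\<nu> + real k)"
    using assms by (simp add: Gamma_plus_of_nat)
  have "Gamma (\<nu> + real k + 1) = (\<nu> + real k) * Gamma (\<nu> + real k)"
    using assms by (intro Gamma_plus1) (auto elim!: nonpos_Ints_cases)
  then have G1: "1 / Gamma (\<nu> + real k) = (\<nu> + real k) / Gamma (\<nu> + real k + 1)"
    using assms by simp
  have P: "x powr \<nu> / 2 powr (\<nu> - 1) = 2 * (x / 2) powr \<nu>"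
    using assms by (simp add: powr_divide powr_diff)
  have "x powr \<nu> / (2 powr (\<nu> - 1) * Gamma \<nu>)
      * (pochhammer (1/2) k / (pochhammer (3/2) k * pochhammer \<nu> k) * ((x\<^sup>2 / 4) ^ k / fact k))
    = (x powr \<nu> / 2 powr (\<nu> - 1)) * (pochhammer (1/2) k / pochhammer (3/2) k)
      * (1 / (Gamma \<nu> * pochhammer \<nu> k)) * ((x\<^sup>2 / 4) ^ k / fact k)"
    by (simp add: mult_ac)
  also have "\<dots> = bessel_I_term \<nu> x k * (2 * (\<nu> + real k) / (2 * real k + 1))"
    unfolding ratio G G1 P bessel_I_term_def half_powr_plus_twice[OF assms(2)]
    by (simp add: divide_simps)
  finally show ?thesis .
qed

theorem corollary2p11:
  fixes \<nu> :: real
  assumes "\<nu> > 1 / 2"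
  shows "\<forall>x::real. x > 0 \<longrightarrow>
    bessel_I \<nu> x < x powr \<nu> / (2 powr (\<nu> - 1) * Gamma \<nu>) * hypergeo_1F2 (1/2) (3/2) \<nu> (x\<^sup>2 / 4) \<and>
    x powr \<nu> / (2 powr (\<nu> - 1) * Gamma \<nu>) * hypergeo_1F2 (1/2) (3/2) \<nu> (x\<^sup>2 / 4)
      < 2 * \<nu> * bessel_I \<nu> x - (2 * \<nu> - 1) * bessel_I (\<nu> + 2) x"
proof (intro allI impI)
  fix x :: real
  assume x: "x > 0"
  define t where "t = bessel_I_term \<nu> x"
  define c where "c = x powr \<nu> / (2 powr (\<nu> - 1) * Gamma \<nu>)"
  define h where "h = (\<lambda>k. pochhammer (1/2) k / (pochhammer (3/2) k * pochhammer \<nu> k)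
    * ((x\<^sup>2 / 4) ^ k / fact k))"
  define m where "m = (\<lambda>k. t k * (2 * (\<nu> + real k) / (2 * real k + 1)))"
  define u where "u = (\<lambda>k. 2 * \<nu> * t k - (2 * \<nu> - 1) * (t k * (real k / (\<nu> + real k + 1))))"
  have t_pos: "t k > 0" for k
    unfolding t_def using assms x by (intro bessel_I_term_pos) auto
  have t_summable: "summable t"
    unfolding t_def using assms x by (intro summable_bessel_I_term) auto
  have u_sums: "u sums (2 * \<nu> * bessel_I \<nu> x - (2 * \<nu> - 1) * bessel_I (\<nu> + 2) x)"
    unfolding u_def bessel_I_eq_suminf[of \<nu>] t_def[symmetric]
    using bessel_I_add_2_sums[of \<nu> x] assms x t_summable
    by (intro sums_diff sums_mult summable_sums) (auto simp: t_def)
  \<comment> \<open>This amounts to \<open>2 * k + 1 < 2 * (\<nu> + k)\<close>, that is,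
    \<open>\<nu> > 1/2\<close>.\<close>
  have t_less_m: "t k < m k" for k
    using t_pos[of k] assms by (simp add: m_def field_simps)
  \<comment> \<open>Over the common denominator the numerator of the relative coefficients collapses
    to \<open>k * (4 * \<nu>\<^sup>2 - 1)\<close>: nonnegative, zero at \<open>k = 0\<close> and
    positive from \<open>k = 1\<close> on.\<close>
  have u_minus_m: "u k - m k = t k * (2 * \<nu> - 1) * (real k * (2 * \<nu> + 1))
      / ((\<nu> + real k + 1) * (2 * real k + 1))" for k
  proof -
    have "\<nu> + real k + 1 \<noteq> 0" "2 * real k + 1 \<noteq> 0" using assms by linarith+
    then show ?thesis
      unfolding u_def m_def by (simp add: divide_simps) algebra
  qed
  have m_le_u: "m k \<le> u k" for k
  proof -
    have "0 \<le> u k - m k"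
      unfolding u_minus_m using t_pos[of k] assms by simp
    then show ?thesis by simp
  qed
  have m_less_u: "m 1 < u 1"
  proof -
    have "0 < u 1 - m 1"
      unfolding u_minus_m using t_pos[of 1] assms by simp
    then show ?thesis by simp
  qed
  \<comment> \<open>Convergence of the hypergeometric series comes from the comparison itself, since
    \<open>0 < t k < m k \<le> u k\<close> and \<open>u\<close> is summable.\<close>
  have m_summable: "summable m"
  proof (rule summable_comparison_test'[OF sums_summable[OF u_sums]])
    show "norm (m k) \<le> u k" if "k \<ge> 0" for k
      using m_le_u[of k] t_less_m[of k] t_pos[of k] by simp
  qed
  have m_eq: "m = (\<lambda>k. c * h k)"
    unfolding m_def t_def c_def h_def using hypergeo_1F2_half_term[of \<nu> x] assms x by simp
  have "Gamma \<nu> > 0"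
    using assms by (intro Gamma_real_pos) simp
  \<comment> \<open>A nonzero \<open>c\<close> lets summability pass from \<open>c * h k\<close> to
    \<open>h k\<close>, so that \<open>c\<close> can be pulled out of the sum.\<close>
  then have "c \<noteq> 0"
    using x by (simp add: c_def)
  then have "summable h"
    using m_summable by (simp add: m_eq summable_cmult_iff)
  then have "suminf m = c * hypergeo_1F2 (1/2) (3/2) \<nu> (x\<^sup>2 / 4)"
    unfolding m_eq hypergeo_1F2_def h_def by (rule suminf_mult)
  moreover have "bessel_I \<nu> x < suminf m"
    unfolding bessel_I_eq_suminf t_def[symmetric]
    by (rule suminf_strict_mono[OF t_summable m_summable]) (use t_less_m in \<open>auto intro: less_imp_le\<close>)
  moreover have "suminf m < suminf u"
    by (rule suminf_strict_mono[OF m_summable sums_summable[OF u_sums] m_le_u m_less_u])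
  ultimately show "bessel_I \<nu> x
      < x powr \<nu> / (2 powr (\<nu> - 1) * Gamma \<nu>) * hypergeo_1F2 (1/2) (3/2) \<nu> (x\<^sup>2 / 4) \<and>
    x powr \<nu> / (2 powr (\<nu> - 1) * Gamma \<nu>) * hypergeo_1F2 (1/2) (3/2) \<nu> (x\<^sup>2 / 4)
      < 2 * \<nu> * bessel_I \<nu> x - (2 * \<nu> - 1) * bessel_I (\<nu> + 2) x"
    using sums_unique[OF u_sums] by (simp add: c_def)
qed

end
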